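(* Let $n\ge2$ and let $G=(V,E)$ be a $k$-edge-connected graph on $n$ vertices with $k\ge 7\log_2 n$. Then $G$ has a hierarchy $\mathcal T$ that is a $(k/20,1/4,T)$-LCH of $G$, where $T$ is the set of all non-root nodes of $\mathcal T$, and such that for every non-leaf node $t$ of $\mathcal T$ the graph $G\{t\}$ is a $(1/k)$-expander.
   Context: Graphs are finite, undirected, unweighted, loopless, possibly with parallel edges; $k$-edge-connected means every cut $(S,\overline S)$, $\emptyset\ne S\subsetneq V$, has at least $k$ edges (a one-vertex graph counts as $k$-edge-connected). For a graph $H$ and $S\subseteq V(H)$: $\partial_H(S)$ is the number of edges leaving $S$, $d_H(S)$ is the sum of degrees of vertices of $S$, and $\phi(H)=\min_{\emptyset\ne S\subsetneq V(H)}\partial_H(S)/\min\{d_H(S),d_H(V(H)\setminus S)\}$; $H$ is an $\epsilon$-expander if $\phi(H)\ge\epsilon$. A hierarchy of $G$ is a rooted tree $\mathcal T$ in which every non-leaf node has at least two children and whose leaves are in bijection with $V$. For a node $t$: $V(t)$ is the set of vertices at the leaves of its subtree; $E(t)$ the edges inside $V(t)$; $G(t)=(V(t),E(t))$; $\mathcal P(t)=E(V(t),V\setminus V(t))$; for non-root $t$ with parent $t^*$, $\mathcal O(t)=E(V(t),V(t^* )\setminus V(t))$. For $k>0$, $0<\lambda<1$ and a set $T$ of non-root nodes, $\mathcal T$ is a $(k,\lambda,T)$-LCH if $G(t)$ is $k$-edge-connected for all nodes $t$ and $|\mathcal O(t)|\ge\lambda|\mathcal P(t)|$ for all $t\in T$.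 For a non-leaf node $t$ with children $t_1,\dots,t_j$, $G\{t\}$ is the multigraph obtained from $G(t)$ by contracting each $V(t_i)$ into a single vertex and deleting loops. *)

theory Defs
  imports Main "HOL-Library.Multiset" Complex_Main
begin

definition multigraph :: "'a set \<Rightarrow> 'a set multiset \<Rightarrow> bool" where
  "multigraph V E \<longleftrightarrow> finite V \<and> (\<forall>e\<in>#E. card e = 2 \<and> e \<subseteq> V)"

definition bnd :: "'a set multiset \<Rightarrow> 'a set \<Rightarrow> nat" where
  "bnd E S = size (filter_mset (\<lambda>e. card (e \<inter> S) = 1) E)"

definition deg :: "'a set multiset \<Rightarrow> 'a \<Rightarrow> nat" where
  "deg E v = size (filter_mset (\<lambda>e. v \<in> e) E)"

definition dsum :: "'a set multiset \<Rightarrow> 'a set \<Rightarrow> nat" where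
  "dsum E S = (\<Sum>v\<in>S. deg E v)"

definition k_edge_connected :: "'a set \<Rightarrow> 'a set multiset \<Rightarrow> real \<Rightarrow> bool" where
  "k_edge_connected V E k \<longleftrightarrow> (\<forall>S. S \<noteq> {} \<and> S \<subset> V \<longrightarrow> real (bnd E S) \<ge> k)"

text \<open>phi(H) >= eps, written multiplicatively (min over all nonempty proper S of
  the ratio is at least eps)\<close>
definition expander :: "'a set \<Rightarrow> 'a set multiset \<Rightarrow> real \<Rightarrow> bool" where
  "expander V E eps \<longleftrightarrow> (\<forall>S. S \<noteq> {} \<and> S \<subset> V \<longrightarrow>
      real (bnd E S) \<ge> eps * real (min (dsum E S) (dsum E (V - S))))"

text \<open>Rooted trees: node set N, root r, parent map par (with par r = r).\<close>

definition children :: "'n set \<Rightarrow> 'n \<Rightarrow> ('n \<Rightarrow> 'n) \<Rightarrow> 'n \<Rightarrow> 'n set" where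
  "children N r par t = {s\<in>N. s \<noteq> r \<and> par s = t}"

definition tleaves :: "'n set \<Rightarrow> 'n \<Rightarrow> ('n \<Rightarrow> 'n) \<Rightarrow> 'n set" where
  "tleaves N r par = {t\<in>N. children N r par t = {}}"

definition subtree :: "'n set \<Rightarrow> ('n \<Rightarrow> 'n) \<Rightarrow> 'n \<Rightarrow> 'n set" where
  "subtree N par t = {s\<in>N. \<exists>i. (par ^^ i) s = t}"

definition hierarchy :: "'a set \<Rightarrow> 'n set \<Rightarrow> 'n \<Rightarrow> ('n \<Rightarrow> 'n) \<Rightarrow> ('n \<Rightarrow> 'a) \<Rightarrow> bool" where
  "hierarchy V N r par lf \<longleftrightarrow>
     finite N \<and> r \<in> N \<and> par r = r \<and>
     (\<forall>t\<in>N - {r}. par t \<in> N) \<and>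
     (\<forall>t\<in>N. \<exists>i. (par ^^ i) t = r) \<and>
     (\<forall>t\<in>N. children N r par t \<noteq> {} \<longrightarrow> card (children N r par t) \<ge> 2) \<and>
     bij_betw lf (tleaves N r par) V"

definition Vt :: "'n set \<Rightarrow> 'n \<Rightarrow> ('n \<Rightarrow> 'n) \<Rightarrow> ('n \<Rightarrow> 'a) \<Rightarrow> 'n \<Rightarrow> 'a set" where
  "Vt N r par lf t = lf ` (tleaves N r par \<inter> subtree N par t)"

definition Ein :: "'a set multiset \<Rightarrow> 'a set \<Rightarrow> 'a set multiset" where
  "Ein E X = filter_mset (\<lambda>e. e \<subseteq> X) E"

definition Pcount :: "'a set multiset \<Rightarrow> 'a set \<Rightarrow> 'a set \<Rightarrow> nat" where
  "Pcount E V X = size (filter_mset (\<lambda>e. card (e \<inter> X) = 1 \<and> card (e \<inter> (V - X)) = 1) E)"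

definition Ocount :: "'a set multiset \<Rightarrow> 'a set \<Rightarrow> 'a set \<Rightarrow> nat" where
  "Ocount E X Y = size (filter_mset (\<lambda>e. card (e \<inter> X) = 1 \<and> card (e \<inter> (Y - X)) = 1) E)"

definition LCH :: "'a set \<Rightarrow> 'a set multiset \<Rightarrow> 'n set \<Rightarrow> 'n \<Rightarrow> ('n \<Rightarrow> 'n) \<Rightarrow> ('n \<Rightarrow> 'a)
                    \<Rightarrow> real \<Rightarrow> real \<Rightarrow> 'n set \<Rightarrow> bool" where
  "LCH V E N r par lf k lam T \<longleftrightarrow>
     hierarchy V N r par lf \<and> T \<subseteq> N - {r} \<and>
     (\<forall>t\<in>N. k_edge_connected (Vt N r par lf t) (Ein E (Vt N r par lf t)) k) \<and>
     (\<forall>t\<in>T. real (Ocount E (Vt N r par lf t) (Vt N r par lf (par t)))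
               \<ge> lam * real (Pcount E V (Vt N r par lf t)))"

text \<open>G{t}: contract each child's vertex set of G(t) to the child node, delete loops.\<close>
definition child_of :: "'n set \<Rightarrow> 'n \<Rightarrow> ('n \<Rightarrow> 'n) \<Rightarrow> ('n \<Rightarrow> 'a) \<Rightarrow> 'n \<Rightarrow> 'a \<Rightarrow> 'n" where
  "child_of N r par lf t v = (THE c. c \<in> children N r par t \<and> v \<in> Vt N r par lf c)"

definition contracted_edges :: "'a set multiset \<Rightarrow> 'n set \<Rightarrow> 'n \<Rightarrow> ('n \<Rightarrow> 'n) \<Rightarrow> ('n \<Rightarrow> 'a)
                                 \<Rightarrow> 'n \<Rightarrow> 'n set multiset" where
  "contracted_edges E N r par lf t =
     image_mset (\<lambda>e. child_of N r par lf t ` e)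
       (filter_mset (\<lambda>e. card (child_of N r par lf t ` e) = 2) (Ein E (Vt N r par lf t)))"

end

theory Submission
  imports Defs "HOL-Library.Disjoint_Sets"
begin

text \<open>
  The hierarchy is grown bottom-up: from a partition of \<open>V\<close> into current blocks, one finds a set
  \<open>S\<close> of at least two blocks that can be merged into a new node, and repeats. Write \<open>vol S\<close> for
  the sum of the boundary sizes of the blocks of \<open>S\<close>. A suitable \<open>S\<close> is an inclusion-minimal nonempty
  set of blocks with \<open>g S \<le> 0\<close>, where

  \<open>g S = \<partial>(\<Union>S) + (2/k) vol S log |S| - (2/7) vol S - k/10\<close>.

  The whole partition satisfies \<open>g \<le> 0\<close> because \<open>7 log n \<le> k\<close>, and a single block does not, because its
  boundary has size at least \<open>k\<close>. Splitting \<open>S\<close> along a cut with \<open>x\<close> edges adds \<open>2x\<close> to the total boundary,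
  whereas the logarithm gains \<open>(2/k) vol A\<close> on the side \<open>A\<close> with fewer blocks and the constant gains \<open>k/10\<close>.
  Hence a cut with \<open>x < k/20\<close> or \<open>x < (1/k) min (vol A) (vol (S - A))\<close> would leave a side with \<open>g \<le> 0\<close>.
  Likewise, removing a block that has less than a quarter of its boundary inside \<open>S\<close> would decrease \<open>g\<close>.
\<close>

section \<open>Counting boundary edges\<close>

text \<open>An edge between \<open>U\<close> and \<open>W\<close> counts twice on the left and never
  in \<open>bnd E (U \<union> W)\<close>; every other edge counts equally on both sides. This is the
  source of the \<open>2x\<close> that a split adds.\<close>

lemma bnd_split:
  assumes "\<forall>e\<in>#E. card e = 2" and "U \<inter> W = {}"
  shows "bnd E U + bnd E W = bnd E (U \<union> W) + 2 * bnd (Ein E (U \<union> W)) U"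
  using assms(1)
proof (induction E)
  case empty
  then show ?case by (simp add: bnd_def Ein_def)
next
  case (add e E)
  then obtain a b where e: "e = {a, b}" "a \<noteq> b"
    by (metis card_2_iff union_single_eq_member)
  have IH: "bnd E U + bnd E W = bnd E (U \<union> W) + 2 * bnd (Ein E (U \<union> W)) U"
    using add by simp
  show ?case
    using IH e assms(2)
    by (cases "a \<in> U"; cases "b \<in> U"; cases "a \<in> W"; cases "b \<in> W")
       (auto simp: bnd_def Ein_def Int_insert_left)
qed

lemma bnd_Ein_le: "bnd (Ein E X) U \<le> bnd E U"
  by (auto simp: bnd_def Ein_def intro!: size_mset_mono multiset_filter_mono)

text \<open>Passing from \<open>X\<close> to \<open>c\<close> only discards edges. Lower bounds for
  cuts of a child thus carry over to every cut of its parent that splits the child.\<close>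

lemma bnd_Ein_mono:
  assumes "c \<subseteq> X"
  shows "bnd (Ein E c) (c \<inter> U) \<le> bnd (Ein E X) U"
proof -
  have "filter_mset (\<lambda>e. e \<subseteq> c \<and> card (e \<inter> (c \<inter> U)) = 1) E \<subseteq>#
      filter_mset (\<lambda>e. e \<subseteq> X \<and> card (e \<inter> U) = 1) E"
    by (rule filter_mset_mono_strong) (use assms in \<open>auto simp: Int_assoc[symmetric] Int_absorb2\<close>)
  then show ?thesis
    unfolding bnd_def Ein_def filter_filter_mset by (rule size_mset_mono)
qed

lemma card_partition_le:
  assumes "finite V" "partition_on V P"
  shows "card P \<le> card V"
proof -
  have "finite B \<and> B \<noteq> {}" if "B \<in> P" for B
    using assms that by (auto simp: partition_on_def intro: finite_subset)
  then have "(\<Sum>B\<in>P. 1) \<le> (\<Sum>B\<in>P. \<Sum>x\<in>B. 1 :: nat)"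
    by (intro sum_mono) (simp add: Suc_le_eq card_gt_0_iff)
  also have "\<dots> = (\<Sum>x\<in>V. 1)"
    by (rule sum.partition[OF assms, symmetric])
  finally show ?thesis by simp
qed

section \<open>Sets of blocks with well-behaved cuts\<close>

text \<open>The blocks \<open>C\<close> stand for the vertices of a contracted graph, which itself is never formed.\<close>

definition well_cut :: "'a set multiset \<Rightarrow> real \<Rightarrow> 'a set set \<Rightarrow> bool" where
  "well_cut E k C \<longleftrightarrow>
     (\<forall>B\<in>C. real (bnd (Ein E (\<Union>C)) B) \<ge> 1/4 * real (bnd E B)) \<and>
     (\<forall>A. A \<noteq> {} \<and> A \<subset> C \<longrightarrow>
        real (bnd (Ein E (\<Union>C)) (\<Union>A)) \<ge> k / 20 \<and>
        real (bnd (Ein E (\<Union>C)) (\<Union>A)) \<ge>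
          1 / k * real (min (\<Sum>B\<in>A. bnd (Ein E (\<Union>C)) B) (\<Sum>B\<in>C - A. bnd (Ein E (\<Union>C)) B)))"

lemma well_cutD:
  assumes "well_cut E k C"
  shows "B \<in> C \<Longrightarrow> 1/4 * real (bnd E B) \<le> real (bnd (Ein E (\<Union>C)) B)"
    and "A \<noteq> {} \<Longrightarrow> A \<subset> C \<Longrightarrow> k / 20 \<le> real (bnd (Ein E (\<Union>C)) (\<Union>A))"
    and "A \<noteq> {} \<Longrightarrow> A \<subset> C \<Longrightarrow>
      1 / k * real (min (\<Sum>B\<in>A. bnd (Ein E (\<Union>C)) B) (\<Sum>B\<in>C - A. bnd (Ein E (\<Union>C)) B))
        \<le> real (bnd (Ein E (\<Union>C)) (\<Union>A))"
  using assms unfolding well_cut_def by simp_all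

lemma exists_well_cut:
  fixes k :: real
  assumes fin: "finite V" and two: "\<forall>e\<in>#E. card e = 2" and sub: "\<forall>e\<in>#E. e \<subseteq> V"
    and conn: "k_edge_connected V E k"
    and k: "0 < k" "7 * log 2 (real (card V)) \<le> k"
    and P: "partition_on V P" "2 \<le> card P"
  shows "\<exists>S\<subseteq>P. 2 \<le> card S \<and> well_cut E k S"
proof -
  define vol where "vol A = (\<Sum>B\<in>A. real (bnd E B))" for A :: "'a set set"
  define g where "g A = real (bnd E (\<Union>A)) + 2 / k * (vol A * log 2 (real (card A)))
      - 2 / 7 * vol A - k / 10" for A
  have finP: "finite P" using fin P by (metis finite_elements)
  have Pne: "P \<noteq> {}" using P by auto
  have vol_nonneg: "0 \<le> vol A" for A unfolding vol_def by (simp add: sum_nonneg)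
  have bndk: "k \<le> real (bnd E B)" if "B \<in> P" for B
  proof -
    have "B \<noteq> {}" "B \<subseteq> V" using that P by (auto simp: partition_on_def)
    \<comment> \<open>\<open>conn\<close> speaks of proper subsets only; \<open>B = V\<close> would
      make \<open>V\<close> the sole block.\<close>
    moreover have "B \<noteq> V"
    proof
      assume "B = V"
      have "P \<subseteq> {V}"
      proof
        fix B' assume "B' \<in> P"
        then have "B' \<noteq> {}" "B' \<subseteq> V" "B' \<noteq> B \<longrightarrow> B' \<inter> B = {}"
          using P that by (auto simp: partition_on_def disjoint_def)
        then show "B' \<in> {V}" using \<open>B = V\<close> by auto
      qed
      then have "card P \<le> card {V}" by (intro card_mono) auto
      then show False using P by simp
    qed
    ultimately show ?thesis using conn unfolding k_edge_connected_def by blast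
  qed
  have bndV: "bnd E V = 0"
    using two sub by (auto simp: bnd_def Int_absorb2 filter_mset_eq_conv)
  have split: "vol A + vol (S - A) = vol S"
    and split_bnd: "real (bnd E (\<Union>A)) + real (bnd E (\<Union>(S - A))) =
           real (bnd E (\<Union>S)) + 2 * real (bnd (Ein E (\<Union>S)) (\<Union>A))"
    if "A \<subseteq> S" "S \<subseteq> P" for A S
  proof -
    have "finite S" using that finP finite_subset by blast
    then show "vol A + vol (S - A) = vol S"
      unfolding vol_def using that(1) by (simp add: sum.subset_diff[of A S])
    have "\<Union>A \<inter> \<Union>(S - A) = {}"
    proof -
      have "B \<inter> B' = {}" if "B \<in> A" "B' \<in> S - A" for B B'
        using that \<open>A \<subseteq> S\<close> \<open>S \<subseteq> P\<close> partition_onD2[OF P(1)]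
        by (intro disjointD[of P]) auto
      then show ?thesis by blast
    qed
    moreover have "\<Union>A \<union> \<Union>(S - A) = \<Union>S" using that by auto
    ultimately show "real (bnd E (\<Union>A)) + real (bnd E (\<Union>(S - A))) =
           real (bnd E (\<Union>S)) + 2 * real (bnd (Ein E (\<Union>S)) (\<Union>A))"
      using bnd_split[OF two, of "\<Union>A" "\<Union>(S - A)"] by simp
  qed
  \<comment> \<open>Here the lower bound on \<open>k\<close> enters. It fixes the constant
    \<open>2/7\<close> in \<open>g\<close>: on all of \<open>P\<close> the logarithmic term is then
    absorbed by the linear one.\<close>
  have logn: "2 / k * log 2 (real (card P)) \<le> 2 / 7"
  proof -
    have "log 2 (real (card P)) \<le> log 2 (real (card V))"
      using card_partition_le[OF fin P(1)] P(2) by simp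
    then have "7 * log 2 (real (card P)) \<le> k" using k by linarith
    then show ?thesis using k by (simp add: field_simps)
  qed
  have gP: "g P \<le> 0"
  proof -
    have "\<Union>P = V" using P by (simp add: partition_on_def)
    moreover have "2 / k * (vol P * log 2 (real (card P))) \<le> 2 / 7 * vol P"
      using mult_right_mono[OF logn vol_nonneg[of P]] by (simp add: mult_ac)
    ultimately show ?thesis unfolding g_def using bndV k by simp
  qed
  \<comment> \<open>The logarithm vanishes, so \<open>g {B}\<close> is
    \<open>5/7 * bnd E B - k/10\<close>, which is at least \<open>43/70 * k\<close>.\<close>
  have g1: "0 < g {B}" if "B \<in> P" for B
    using bndk[OF that] k by (simp add: g_def vol_def)
  \<comment> \<open>Since \<open>g {} = - k / 10\<close> is negative, the empty set has to be
    excluded, or it would be the minimal set.\<close>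
  define Fam where "Fam = {A. A \<subseteq> P \<and> A \<noteq> {} \<and> g A \<le> 0}"
  have "finite Fam" unfolding Fam_def using finP by simp
  moreover have "P \<in> Fam" unfolding Fam_def using gP Pne by simp
  ultimately obtain S where S: "S \<in> Fam" "\<And>A. A \<in> Fam \<Longrightarrow> A \<subseteq> S \<Longrightarrow> A = S"
    using finite_has_minimal[of Fam] by blast
  have SP: "S \<subseteq> P" "S \<noteq> {}" "g S \<le> 0" and finS: "finite S"
    using S(1) finP finite_subset by (auto simp: Fam_def)
  have pos: "0 < g A" if "A \<subset> S" "A \<noteq> {}" for A
    using S(2)[of A] that SP by (force simp: Fam_def)
  have card2: "2 \<le> card S"
  proof (rule ccontr)
    assume "\<not> 2 \<le> card S"
    then have "card S = 1" using card_gt_0_iff[of S] SP finS by linarith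
    then obtain B where "S = {B}" by (auto simp: card_1_singleton_iff)
    then show False using g1[of B] SP by auto
  qed
  let ?b = "\<lambda>U. real (bnd (Ein E (\<Union>S)) U)"
  have gain: "vol A * log 2 (real (card A)) \<le> vol A * log 2 (real (card S))"
    if "A \<subseteq> S" "A \<noteq> {}" for A
  proof -
    have "0 < card A" "card A \<le> card S"
      using that finS by (auto simp: card_gt_0_iff finite_subset card_mono)
    then show ?thesis by (intro mult_left_mono vol_nonneg) simp
  qed
  \<comment> \<open>Base 2 makes halving the number of blocks lower the logarithm by at least 1, so
    the smaller side saves its whole volume.\<close>
  have half: "vol A * log 2 (real (card A)) \<le> vol A * log 2 (real (card S)) - vol A"
    if "A \<subseteq> S" "A \<noteq> {}" "2 * card A \<le> card S" for A
  proof -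
    have "0 < card A" using that finS by (auto simp: card_gt_0_iff finite_subset)
    then have "log 2 (real (2 * card A)) = 1 + log 2 (real (card A))"
      by (simp add: log_mult)
    moreover have "log 2 (real (2 * card A)) \<le> log 2 (real (card S))"
      using that \<open>0 < card A\<close> by (subst log_le_cancel_iff) auto
    ultimately have "log 2 (real (card A)) \<le> log 2 (real (card S)) - 1" by simp
    from mult_left_mono[OF this vol_nonneg] show ?thesis by (simp add: algebra_simps)
  qed
  \<comment> \<open>This is \<open>g S < g A + g (S - A)\<close> written out: the \<open>2/7\<close>
    terms cancel because \<open>vol\<close> is additive, one copy of \<open>k / 10\<close> remains,
    and the boundaries differ by twice the cut.\<close>
  have cut_gain: "k / 10 + 2 / k * (vol A * log 2 (real (card S)) + vol (S - A) * log 2 (real (card S))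
        - vol A * log 2 (real (card A)) - vol (S - A) * log 2 (real (card (S - A)))) < 2 * ?b (\<Union>A)"
    if "A \<subset> S" "A \<noteq> {}" for A
  proof -
    have "0 < g A" "0 < g (S - A)" using that by (auto intro!: pos)
    then have "g S < g A + g (S - A)" using SP by simp
    moreover have vS: "vol S = vol A + vol (S - A)" using split[of A S] that SP by auto
    moreover have "real (bnd E (\<Union>A)) + real (bnd E (\<Union>(S - A))) =
           real (bnd E (\<Union>S)) + 2 * ?b (\<Union>A)"
      using split_bnd[of A S] that SP by auto
    ultimately show ?thesis unfolding g_def vS ring_distribs by linarith
  qed
  have "well_cut E k S"
    unfolding well_cut_def
  proof (intro conjI allI impI ballI)
    fix B assume B: "B \<in> S"
    show "1 / 4 * real (bnd E B) \<le> ?b B"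
    proof -
      let ?W = "S - {B}"
      have W: "?W \<subset> S" "?W \<noteq> {}" using B card2 by (auto simp: subset_singleton_iff)
      then have "0 < g ?W" by (rule pos)
      moreover have vols: "vol ?W + real (bnd E B) = vol S"
        using split[of "{B}" S] B SP by (simp add: vol_def)
      moreover have "real (bnd E B) + real (bnd E (\<Union>?W)) = real (bnd E (\<Union>S)) + 2 * ?b B"
        using split_bnd[of "{B}" S] B SP by simp
      moreover have "vol ?W * log 2 (real (card ?W)) \<le> vol S * log 2 (real (card S))"
      proof -
        have "vol ?W * log 2 (real (card ?W)) \<le> vol ?W * log 2 (real (card S))"
          using gain[of ?W] W by auto
        also have "\<dots> \<le> vol S * log 2 (real (card S))"
          using vols card2 by (intro mult_right_mono) auto
        finally show ?thesis .
      qed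
      then have "2 / k * (vol ?W * log 2 (real (card ?W))) \<le> 2 / k * (vol S * log 2 (real (card S)))"
        using k by (intro mult_left_mono) auto
      \<comment> \<open>From \<open>g S < g ?W\<close> it follows that
        \<open>2 * ?b B > (1 - 2/7) * bnd E B\<close>, a fraction \<open>5/14\<close> of the
        boundary, which is more than \<open>1/4\<close>.\<close>
      ultimately show ?thesis using SP(3) unfolding g_def by linarith
    qed
  next
    fix A assume A: "A \<noteq> {} \<and> A \<subset> S"
    then have A': "A \<subset> S" "A \<noteq> {}" "A \<subseteq> S" "S - A \<subseteq> S" "S - A \<noteq> {}" by auto
    let ?gain = "vol A * log 2 (real (card S)) + vol (S - A) * log 2 (real (card S))
        - vol A * log 2 (real (card A)) - vol (S - A) * log 2 (real (card (S - A)))"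
    have "0 \<le> ?gain" using gain[of A] gain[of "S - A"] A' by linarith
    then have "0 \<le> 2 / k * ?gain" using k by simp
    then show "k / 20 \<le> ?b (\<Union>A)" using cut_gain[of A] A' by linarith
    \<comment> \<open>The expander condition counts only edges inside \<open>\<Union>S\<close>,
      whereas \<open>vol\<close> counts full boundaries; a bound in terms of \<open>vol\<close> is
      therefore the stronger one.\<close>
    have le_vol: "real (\<Sum>B\<in>A. bnd (Ein E (\<Union>S)) B) \<le> vol A" for A
      unfolding vol_def of_nat_sum by (intro sum_mono) (simp add: bnd_Ein_le)
    have "card A + card (S - A) = card S"
      using A' finS by (metis card_Diff_subset card_mono finite_subset le_add_diff_inverse)
    \<comment> \<open>The side with at most half of the blocks gains its own volume and the other
      side gains at least 0. Whichever side it is, the minimum of the two volumes is a lower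
      bound.\<close>
    then have "2 * card A \<le> card S \<or> 2 * card (S - A) \<le> card S" by linarith
    then have "min (vol A) (vol (S - A)) \<le> ?gain"
      using half[of A] half[of "S - A"] gain[of A] gain[of "S - A"] A' by linarith
    then have "2 / k * min (vol A) (vol (S - A)) \<le> 2 / k * ?gain"
      using k by (intro mult_left_mono) auto
    then have "1 / k * min (vol A) (vol (S - A)) \<le> ?b (\<Union>A)"
      using cut_gain[of A] A' k by linarith
    moreover have "real (min (\<Sum>B\<in>A. bnd (Ein E (\<Union>S)) B) (\<Sum>B\<in>S - A. bnd (Ein E (\<Union>S)) B))
        \<le> min (vol A) (vol (S - A))"
      using min.mono[OF le_vol[of A] le_vol[of "S - A"]] by (simp only: of_nat_min)
    then have "1 / k * real (min (\<Sum>B\<in>A. bnd (Ein E (\<Union>S)) B) (\<Sum>B\<in>S - A. bnd (Ein E (\<Union>S)) B))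
        \<le> 1 / k * min (vol A) (vol (S - A))"
      using k by (intro mult_left_mono) auto
    ultimately show "1 / k * real (min (\<Sum>B\<in>A. bnd (Ein E (\<Union>S)) B) (\<Sum>B\<in>S - A. bnd (Ein E (\<Union>S)) B))
        \<le> ?b (\<Union>A)" by linarith
  qed
  then show ?thesis using SP card2 by blast
qed

section \<open>Laminar families of vertex sets\<close>

text \<open>A hierarchy without its tree: \<open>F\<close> holds the vertex sets of the nodes and
  \<open>P\<close> is the lowest level. Members being unions of blocks allows a further level to be
  added below. The last condition makes \<open>C\<close> the maximal members strictly inside
  \<open>X\<close>, which are its future children.\<close>

definition laminar_over ::
    "'a set multiset \<Rightarrow> real \<Rightarrow> 'a set \<Rightarrow> 'a set set \<Rightarrow> 'a set set \<Rightarrow> bool" where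
  "laminar_over E k V P F \<longleftrightarrow>
     P \<subseteq> F \<and> V \<in> F \<and> F \<subseteq> Pow V \<and> {} \<notin> F \<and>
     (\<forall>X\<in>F. \<forall>B\<in>P. B \<subseteq> X \<or> B \<inter> X = {}) \<and>
     (\<forall>X\<in>F. \<forall>Y\<in>F. X \<subseteq> Y \<or> Y \<subseteq> X \<or> X \<inter> Y = {}) \<and>
     (\<forall>X\<in>F - P. \<exists>C\<subseteq>F. 2 \<le> card C \<and> partition_on X C \<and> well_cut E k C \<and>
        (\<forall>Y\<in>F. Y \<subset> X \<longrightarrow> (\<exists>c\<in>C. Y \<subseteq> c)))"

text \<open>Induction on the number of blocks: a well-cut \<open>S\<close> is merged into one block
  \<open>U\<close>, the coarser partition \<open>Q\<close> yields a family \<open>F\<close>, and the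
  blocks of \<open>S\<close> are then added to \<open>F\<close> as the children of \<open>U\<close>.
  A single block is the base case.\<close>

lemma exists_laminar_family:
  fixes k :: real
  assumes fin: "finite V" and two: "\<forall>e\<in>#E. card e = 2" and sub: "\<forall>e\<in>#E. e \<subseteq> V"
    and conn: "k_edge_connected V E k"
    and k: "0 < k" "7 * log 2 (real (card V)) \<le> k"
    and "partition_on V P" "V \<noteq> {}"
  shows "\<exists>F. laminar_over E k V P F"
  using assms(7)
proof (induction "card P" arbitrary: P rule: less_induct)
  case less
  note P = less.prems
  have finP: "finite P" using fin P by (metis finite_elements)
  have disjP: "B \<inter> B' = {}" if "B \<in> P" "B' \<in> P" "B \<noteq> B'" for B B'
    using that partition_onD2[OF P] by (intro disjointD)
  have neP: "B \<noteq> {}" "B \<subseteq> V" if "B \<in> P" for B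
    using that P by (auto simp: partition_on_def)
  show ?case
  proof (cases "2 \<le> card P")
    case False
    have "P \<noteq> {}" using P assms(8) by (auto simp: partition_on_def)
    then have "card P = 1" using False finP card_gt_0_iff[of P] by linarith
    then have "P = {V}" using P by (auto simp: card_1_singleton_iff partition_on_def)
    then show ?thesis using assms(8) by (intro exI[of _ "{V}"]) (auto simp: laminar_over_def)
  next
    case True
    obtain S where S: "S \<subseteq> P" "2 \<le> card S" "well_cut E k S"
      using exists_well_cut[OF fin two sub conn k P True] by blast
    have finS: "finite S" using S finP finite_subset by blast
    define U where "U = \<Union>S"
    define Q where "Q = insert U (P - S)"
    obtain B0 where B0: "B0 \<in> S" using S(2) by fastforce
    have strict: "B \<subset> U" if B: "B \<in> S" for B
    proof -
      have "S \<noteq> {B}" using S(2) by auto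
      then obtain B' where B': "B' \<in> S" "B' \<noteq> B" using B by auto
      then have "B' \<inter> B = {}" "B' \<noteq> {}"
        using disjP[of B' B] neP(1)[of B'] S(1) B by auto
      then show ?thesis using B' B unfolding U_def by blast
    qed
    have disjU: "B \<inter> U = {}" if "B \<in> P - S" for B
      using disjP that S(1) unfolding U_def by blast
    have UV: "U \<subseteq> V" "U \<noteq> {}" using neP S B0 strict[OF B0] by (auto simp: U_def)
    have Q: "partition_on V Q"
    proof (rule partition_onI)
      show "\<Union>Q = V" using P S by (auto simp: Q_def U_def partition_on_def)
      show "{} \<notin> Q" using neP UV by (auto simp: Q_def)
      fix p q assume "p \<in> Q" "q \<in> Q" "p \<noteq> q"
      then show "disjnt p q"
        using disjP disjU by (auto simp: Q_def disjnt_def)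
    qed
    \<comment> \<open>One block replaces at least two.\<close>
    have "card Q < card P"
    proof -
      have "card Q \<le> Suc (card (P - S))" using finP by (simp add: Q_def card_insert_if)
      moreover have "card (P - S) = card P - card S" using S finS by (simp add: card_Diff_subset)
      moreover have "card S \<le> card P" using S finP card_mono by blast
      ultimately show ?thesis using S(2) by linarith
    qed
    from less.hyps[OF this Q] obtain F where LF: "laminar_over E k V Q F" by blast
    have F: "Q \<subseteq> F" "V \<in> F" "F \<subseteq> Pow V" "{} \<notin> F"
      using LF by (simp_all add: laminar_over_def)
    have union: "B \<subseteq> X \<or> B \<inter> X = {}" if "X \<in> F" "B \<in> Q" for X B
      using LF that by (simp add: laminar_over_def)
    have lam: "X \<subseteq> Y \<or> Y \<subseteq> X \<or> X \<inter> Y = {}" if "X \<in> F" "Y \<in> F" for X Y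
      using LF that by (simp add: laminar_over_def)
    have dec: "\<exists>C\<subseteq>F. 2 \<le> card C \<and> partition_on X C \<and> well_cut E k C \<and>
              (\<forall>Y\<in>F. Y \<subset> X \<longrightarrow> (\<exists>c\<in>C. Y \<subseteq> c))" if "X \<in> F - Q" for X
      using LF that unfolding laminar_over_def by (elim conjE) (rule bspec)
    have UF: "U \<in> F" using F by (auto simp: Q_def)
    have dicho: "U \<subseteq> X \<or> U \<inter> X = {}" if "X \<in> F" for X
      using union[OF that, of U] by (auto simp: Q_def)
    have unionP: "B \<subseteq> X \<or> B \<inter> X = {}" if "X \<in> F" "B \<in> P" for X B
    proof (cases "B \<in> S")
      case True
      then have "B \<subseteq> U" using strict by blast
      then show ?thesis using dicho[OF that(1)] by blast
    next
      case False
      then show ?thesis using union[OF that(1), of B] that by (auto simp: Q_def)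
    qed
    have "laminar_over E k V P (F \<union> S)"
      unfolding laminar_over_def
    proof (intro conjI ballI)
      show "P \<subseteq> F \<union> S" "V \<in> F \<union> S" using F by (auto simp: Q_def)
      show "F \<union> S \<subseteq> Pow V" "{} \<notin> F \<union> S" using F(3,4) neP S(1) by blast+
    next
      fix X B assume "X \<in> F \<union> S" "B \<in> P"
      then show "B \<subseteq> X \<or> B \<inter> X = {}"
        using unionP disjP[of B X] S(1) by blast
    next
      fix X Y assume "X \<in> F \<union> S" "Y \<in> F \<union> S"
      then show "X \<subseteq> Y \<or> Y \<subseteq> X \<or> X \<inter> Y = {}"
        using lam[of X Y] unionP[of X Y] unionP[of Y X] disjP[of X Y] S(1) by blast
    next
      fix X assume X: "X \<in> F \<union> S - P"
      then have XF: "X \<in> F" using S(1) by blast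
      show "\<exists>C\<subseteq>F \<union> S. 2 \<le> card C \<and> partition_on X C \<and> well_cut E k C \<and>
              (\<forall>Y\<in>F \<union> S. Y \<subset> X \<longrightarrow> (\<exists>c\<in>C. Y \<subseteq> c))"
      proof (cases "X = U")
        \<comment> \<open>\<open>U\<close> was a block of \<open>Q\<close> and had no decomposition
          so far; \<open>S\<close> becomes its decomposition.\<close>
        case True
        have "partition_on U S"
        proof (rule partition_onI)
          show "\<Union>S = U" by (simp add: U_def)
          show "{} \<notin> S" using neP(1) S(1) by blast
          show "disjnt p q" if "p \<in> S" "q \<in> S" "p \<noteq> q" for p q
            using that disjP S(1) unfolding disjnt_def by blast
        qed
        moreover have "\<exists>c\<in>S. Y \<subseteq> c" if "Y \<in> F \<union> S" "Y \<subset> U" for Y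
        proof -
          \<comment> \<open>Members of \<open>F\<close> contain \<open>U\<close> or avoid it, so
            only the added blocks lie strictly inside \<open>U\<close>.\<close>
          have "Y \<notin> F"
          proof
            assume "Y \<in> F"
            then have "U \<inter> Y = {}" using dicho[of Y] that(2) by blast
            then have "Y = {}" using that(2) by blast
            then show False using F(4) \<open>Y \<in> F\<close> by simp
          qed
          then show ?thesis using that(1) by blast
        qed
        ultimately show ?thesis using S True by (intro exI[of _ S]) auto
      next
        case False
        then have "X \<in> F - Q" using X XF by (auto simp: Q_def)
        from dec[OF this] obtain C where C: "C \<subseteq> F" "2 \<le> card C" "partition_on X C" "well_cut E k C"
          and "\<forall>Y\<in>F. Y \<subset> X \<longrightarrow> (\<exists>c\<in>C. Y \<subseteq> c)"
          by (elim exE conjE)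
        then have max: "\<exists>c\<in>C. Y \<subseteq> c" if "Y \<in> F" "Y \<subset> X" for Y
          using that by simp
        have "\<exists>c\<in>C. Y \<subseteq> c" if Y: "Y \<in> F \<union> S" "Y \<subset> X" for Y
        proof (cases "Y \<in> F")
          case True
          then show ?thesis using max Y(2) by simp
        next
          case False
          then have "Y \<in> S" using Y(1) by blast
          then have YU: "Y \<subset> U" and "Y \<noteq> {}" using strict neP(1)[of Y] S(1) by auto
          \<comment> \<open>An added block inside \<open>X\<close> forces \<open>U\<close> inside
            \<open>X\<close>, and the part of the old decomposition that covers \<open>U\<close>
            covers the block too.\<close>
          then have "U \<inter> X \<noteq> {}" using Y(2) by blast
          then have "U \<subset> X" using dicho[OF XF] \<open>X \<noteq> U\<close> by blast
          from max[OF UF this] show ?thesis using YU by blast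
        qed
        then show ?thesis using C by (intro exI[of _ C]) auto
      qed
    qed
    then show ?thesis by blast
  qed
qed

section \<open>Connectivity of members and the edge counts of a hierarchy\<close>

text \<open>A cut of \<open>X\<close> either splits some child, where the induction hypothesis gives
  enough edges already inside that child, or is a union of children, where \<open>well_cut\<close>
  applies. Singletons have no cuts.\<close>

lemma k_edge_connected_laminar:
  assumes "finite X" "X \<in> F"
    and dec: "\<And>X. X \<in> F \<Longrightarrow> card X \<noteq> 1 \<Longrightarrow>
      \<exists>C\<subseteq>F. 2 \<le> card C \<and> partition_on X C \<and> well_cut E k C"
  shows "k_edge_connected X (Ein E X) (k / 20)"
  using assms(1,2)
proof (induction "card X" arbitrary: X rule: less_induct)
  case less
  show ?case
    unfolding k_edge_connected_def
  proof (intro allI impI)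
    fix U assume U: "U \<noteq> {} \<and> U \<subset> X"
    have "card X \<noteq> 1" using U by (auto simp: card_1_singleton_iff)
    then obtain C where C: "C \<subseteq> F" "2 \<le> card C" "partition_on X C" "well_cut E k C"
      using dec less.prems by blast
    have UC: "\<Union>C = X" using C by (auto simp: partition_on_def)
    show "k / 20 \<le> real (bnd (Ein E X) U)"
    proof (cases "\<exists>c\<in>C. c \<inter> U \<noteq> {} \<and> \<not> c \<subseteq> U")
      case True
      then obtain c where c: "c \<in> C" "c \<inter> U \<noteq> {}" "\<not> c \<subseteq> U" by blast
      have cX: "c \<subseteq> X" using c UC by blast
      have "c \<noteq> X"
      proof
        assume "c = X"
        have "C \<subseteq> {c}"
        proof
          fix d assume "d \<in> C"
          then have "d \<noteq> {}" "d \<subseteq> c" "d \<noteq> c \<longrightarrow> d \<inter> c = {}"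
            using C(3) c \<open>c = X\<close> by (auto simp: partition_on_def disjoint_def)
          then show "d \<in> {c}" by auto
        qed
        then have "card C \<le> card {c}" by (intro card_mono) auto
        then show False using C(2) by simp
      qed
      then have "card c < card X" using cX less.prems by (intro psubset_card_mono) auto
      then have "k_edge_connected c (Ein E c) (k / 20)"
        using less.hyps[of c] cX less.prems c C(1) finite_subset by blast
      moreover have "c \<inter> U \<subset> c" using c by blast
      ultimately have "k / 20 \<le> real (bnd (Ein E c) (c \<inter> U))"
        using c(2) by (simp add: k_edge_connected_def)
      then show ?thesis using bnd_Ein_mono[OF cX, of E U] by linarith
    next
      case False
      define A where "A = {c \<in> C. c \<subseteq> U}"
      have UA: "\<Union>A = U"
      proof
        show "U \<subseteq> \<Union>A"
        proof
          fix u assume u: "u \<in> U"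
          then obtain c where c: "c \<in> C" "u \<in> c" using U UC by blast
          then have "c \<subseteq> U" using False u by blast
          then show "u \<in> \<Union>A" using c by (auto simp: A_def)
        qed
      qed (auto simp: A_def)
      have "A \<noteq> {}" using UA U by auto
      moreover have "A \<subset> C" using UA U UC by (auto simp: A_def)
      ultimately show ?thesis using well_cutD(2)[OF C(4), of A] UA UC by simp
    qed
  qed
qed

lemma Ocount_eq_bnd_Ein:
  assumes two: "\<forall>e\<in>#E. card e = 2" and "X \<subseteq> Y"
  shows "Ocount E X Y = bnd (Ein E Y) X"
proof -
  have "(card (e \<inter> X) = 1 \<and> card (e \<inter> (Y - X)) = 1) \<longleftrightarrow> (e \<subseteq> Y \<and> card (e \<inter> X) = 1)"
    if e: "e \<in># E" for e
  proof -
    obtain a b where "e = {a, b}" "a \<noteq> b" using two e by (metis card_2_iff)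
    then show ?thesis using \<open>X \<subseteq> Y\<close> by (auto simp: Int_insert_left)
  qed
  then show ?thesis
    unfolding Ocount_def bnd_def Ein_def filter_filter_mset
    by (intro arg_cong[of _ _ size] filter_mset_cong) auto
qed

lemma Pcount_le_bnd:
  assumes "\<forall>e\<in>#E. card e = 2" "X \<subseteq> V"
  shows "Pcount E V X \<le> bnd E X"
  using Ocount_eq_bnd_Ein[OF assms] bnd_Ein_le[of E V X] by (simp add: Pcount_def Ocount_def)

lemma deg_eq_bnd: "deg E v = bnd E {v}"
  unfolding deg_def bnd_def by (auto simp: Int_insert_right intro!: arg_cong[of _ _ size] filter_mset_cong)

section \<open>From a laminar family to a rooted tree\<close>

text \<open>Nodes are abstract names, labelled injectively by their vertex sets, because the final
  tree has natural numbers as nodes. The map \<open>ch\<close> takes the label of a node to the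
  labels of its children.\<close>

locale labelled_laminar_family =
  fixes V :: "'a set" and N :: "'n set" and L :: "'n \<Rightarrow> 'a set" and ch :: "'a set \<Rightarrow> 'a set set"
  assumes finite_V: "finite V" and finite_N: "finite N" and inj_L: "inj_on L N"
    and V_in: "V \<in> L ` N" and sub_V: "t \<in> N \<Longrightarrow> L t \<subseteq> V" and L_ne: "t \<in> N \<Longrightarrow> L t \<noteq> {}"
    and singleton_in: "v \<in> V \<Longrightarrow> {v} \<in> L ` N"
    and laminar: "s \<in> N \<Longrightarrow> t \<in> N \<Longrightarrow> L s \<subseteq> L t \<or> L t \<subseteq> L s \<or> L s \<inter> L t = {}"
    and ch_singleton: "t \<in> N \<Longrightarrow> card (L t) = 1 \<Longrightarrow> ch (L t) = {}"
    and ch_in: "t \<in> N \<Longrightarrow> ch (L t) \<subseteq> L ` N"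
    and ch_card: "t \<in> N \<Longrightarrow> card (L t) \<noteq> 1 \<Longrightarrow> 2 \<le> card (ch (L t))"
    and ch_partition: "t \<in> N \<Longrightarrow> card (L t) \<noteq> 1 \<Longrightarrow> partition_on (L t) (ch (L t))"
    and ch_max: "s \<in> N \<Longrightarrow> t \<in> N \<Longrightarrow> L s \<subset> L t \<Longrightarrow> \<exists>c\<in>ch (L t). L s \<subseteq> c"
begin

definition root :: 'n where "root = inv_into N L V"

text \<open>The first case supplies the fixed point that \<open>hierarchy\<close> demands at the
  root. Elsewhere \<open>children_eq\<close> shows that the choice is unambiguous.\<close>

definition par :: "'n \<Rightarrow> 'n" where
  "par t = (if L t = V then t else SOME p. p \<in> N \<and> L t \<in> ch (L p))"

definition lf :: "'n \<Rightarrow> 'a" where "lf t = the_elem (L t)"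

lemma root: "root \<in> N" "L root = V"
  unfolding root_def using inv_into_into[OF V_in] f_inv_into_f[OF V_in] by auto

lemma eq_root_iff: "t \<in> N \<Longrightarrow> t = root \<longleftrightarrow> L t = V"
  using root inj_L by (auto dest: inj_onD)

lemma finite_L: "t \<in> N \<Longrightarrow> finite (L t)"
  using sub_V finite_V finite_subset by blast

lemma ch_disjoint: "t \<in> N \<Longrightarrow> c \<in> ch (L t) \<Longrightarrow> d \<in> ch (L t) \<Longrightarrow> c \<noteq> d \<Longrightarrow> c \<inter> d = {}"
  using ch_partition[of t] ch_singleton[of t] by (auto simp: partition_on_def disjoint_def)

lemma ch_psubset:
  assumes "t \<in> N" "c \<in> ch (L t)"
  shows "c \<subset> L t"
proof -
  have "card (L t) \<noteq> 1" using assms ch_singleton by auto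
  note * = ch_card[OF assms(1) this] ch_partition[OF assms(1) this]
  have "c \<subseteq> L t" using * assms by (auto simp: partition_on_def)
  moreover have "ch (L t) \<noteq> {c}" using * by auto
  then obtain d where d: "d \<in> ch (L t)" "d \<noteq> c" using assms by auto
  then have "d \<subseteq> L t" "d \<noteq> {}" "d \<inter> c = {}"
    using * assms ch_disjoint by (auto simp: partition_on_def)
  ultimately show ?thesis by blast
qed

text \<open>Take \<open>p\<close> with the smallest label strictly above \<open>L t\<close>. The
  child of \<open>p\<close> that covers \<open>L t\<close> must equal it, as otherwise that child
  would be a smaller candidate.\<close>

lemma par_prop:
  assumes "t \<in> N" "L t \<noteq> V"
  shows "par t \<in> N" "L t \<in> ch (L (par t))"
proof -
  define Z where "Z = {p \<in> N. L t \<subset> L p}"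
  have "root \<in> Z" unfolding Z_def using root sub_V assms by auto
  then obtain p where p: "p \<in> Z" "\<And>q. q \<in> Z \<Longrightarrow> card (L p) \<le> card (L q)"
    using ex_has_least_nat[of "\<lambda>p. p \<in> Z" root "\<lambda>p. card (L p)"] by blast
  obtain c where c: "c \<in> ch (L p)" "L t \<subseteq> c" using p(1) ch_max[of t p] assms by (auto simp: Z_def)
  obtain q where q: "q \<in> N" "c = L q" using c ch_in[of p] p(1) by (auto simp: Z_def)
  have "c \<subset> L p" using ch_psubset c p(1) by (auto simp: Z_def)
  then have "card c < card (L p)" using finite_L p(1) by (auto simp: Z_def intro: psubset_card_mono)
  then have "q \<notin> Z" using p(2)[of q] q by auto
  then have "L t = c" using q c by (auto simp: Z_def)
  then have "\<exists>p. p \<in> N \<and> L t \<in> ch (L p)" using c p(1) by (auto simp: Z_def)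
  from someI_ex[OF this] show "par t \<in> N" "L t \<in> ch (L (par t))"
    using assms by (auto simp: par_def)
qed

text \<open>The parent is the least node strictly above \<open>s\<close>: were \<open>L t\<close>
  strictly inside \<open>L (par s)\<close>, a child of \<open>par s\<close> would contain
  \<open>L t\<close>, hence meet its sibling \<open>L s\<close> without being equal to it.\<close>

lemma par_step:
  assumes "s \<in> N" "t \<in> N" "L s \<subset> L t"
  shows "par s \<in> N" "L s \<in> ch (L (par s))" "L s \<subset> L (par s)" "L (par s) \<subseteq> L t"
proof -
  have "L s \<noteq> V" using assms sub_V by blast
  then show p: "par s \<in> N" "L s \<in> ch (L (par s))" using par_prop assms by auto
  then show ps: "L s \<subset> L (par s)" using ch_psubset by blast
  have "\<not> L t \<subset> L (par s)"
  proof
    assume "L t \<subset> L (par s)"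
    then obtain c where "c \<in> ch (L (par s))" "L t \<subseteq> c" using ch_max assms p by blast
    then show False using ch_disjoint[OF p(1) p(2), of c] assms(3) L_ne[OF assms(1)] by blast
  qed
  then show "L (par s) \<subseteq> L t"
    using laminar[OF p(1) assms(2)] ps assms(3) L_ne[OF assms(1)] by blast
qed

lemma par_funpow:
  assumes "s \<in> N"
  shows "(par ^^ i) s \<in> N \<and> L s \<subseteq> L ((par ^^ i) s)"
proof (induction i)
  case (Suc i)
  let ?q = "(par ^^ i) s"
  have "par ?q \<in> N \<and> L ?q \<subseteq> L (par ?q)"
  proof (cases "L ?q = V")
    case True
    then have "par ?q = ?q" by (simp add: par_def)
    then show ?thesis using Suc by simp
  next
    case False
    then show ?thesis using Suc par_prop[of ?q] ch_psubset by blast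
  qed
  then show ?case using Suc by auto
qed (use assms in simp)

text \<open>By \<open>par_step\<close>, each move to the parent enlarges the label while staying
  within \<open>L t\<close>, so the size gap shrinks until the labels agree.\<close>

lemma reachable:
  assumes "s \<in> N" "t \<in> N" "L s \<subseteq> L t"
  shows "\<exists>i. (par ^^ i) s = t"
  using assms(1,3)
proof (induction "card (L t) - card (L s)" arbitrary: s rule: less_induct)
  case less
  show ?case
  proof (cases "L s = L t")
    case True
    then have "s = t" using inj_L less.prems assms by (auto dest: inj_onD)
    then show ?thesis by (intro exI[of _ 0]) simp
  next
    case False
    then have st: "L s \<subset> L t" using less.prems by blast
    note p = par_step[OF less.prems(1) assms(2) st]
    have "card (L s) < card (L (par s))" "card (L s) < card (L t)"
      using p st finite_L assms by (auto intro: psubset_card_mono)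
    then have "card (L t) - card (L (par s)) < card (L t) - card (L s)" by linarith
    then obtain i where "(par ^^ i) (par s) = t" using less.hyps[of "par s"] p by blast
    then show ?thesis by (intro exI[of _ "Suc i"]) (simp add: funpow_swap1)
  qed
qed

text \<open>If \<open>L s\<close> is in \<open>ch (L t)\<close> but \<open>L (par s)\<close> were
  smaller than \<open>L t\<close>, then another element of \<open>ch (L t)\<close> would contain
  \<open>L (par s)\<close> and overlap \<open>L s\<close>.\<close>

lemma children_eq:
  assumes "t \<in> N"
  shows "children N root par t = {s \<in> N. L s \<in> ch (L t)}"
proof -
  have "s \<noteq> root \<and> par s = t \<longleftrightarrow> L s \<in> ch (L t)" if "s \<in> N" for s
  proof
    assume "s \<noteq> root \<and> par s = t"
    then show "L s \<in> ch (L t)" using par_prop[of s] eq_root_iff that by auto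
  next
    assume s: "L s \<in> ch (L t)"
    then have st: "L s \<subset> L t" using ch_psubset assms by blast
    note p = par_step[OF that assms st]
    have "L (par s) = L t"
    proof (rule ccontr)
      assume "L (par s) \<noteq> L t"
      then obtain c where "c \<in> ch (L t)" "L (par s) \<subseteq> c" using ch_max[of "par s" t] p assms by blast
      then show False using ch_disjoint[OF assms s, of c] p(3) L_ne[OF that] by blast
    qed
    then have "par s = t" using inj_L p assms by (auto dest: inj_onD)
    moreover have "L s \<noteq> V" using st sub_V assms by blast
    ultimately show "s \<noteq> root \<and> par s = t" using eq_root_iff that by auto
  qed
  then show ?thesis by (auto simp: children_def)
qed

lemma L_children: "t \<in> N \<Longrightarrow> L ` children N root par t = ch (L t)"
  using ch_in[of t] by (auto simp: children_eq)

lemma card_children: "t \<in> N \<Longrightarrow> card (children N root par t) = card (ch (L t))"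
  using card_image[OF inj_on_subset[OF inj_L], of "children N root par t"]
  by (simp add: L_children) (simp add: children_def)

lemma tleaves_eq: "tleaves N root par = {t \<in> N. card (L t) = 1}"
proof -
  have "children N root par t = {} \<longleftrightarrow> card (L t) = 1" if "t \<in> N" for t
    using L_children[OF that] ch_singleton[OF that] ch_card[OF that] by fastforce
  then show ?thesis by (auto simp: tleaves_def)
qed

lemma L_leaf:
  assumes "t \<in> tleaves N root par"
  shows "L t = {lf t}"
proof -
  obtain v where "L t = {v}" using assms by (auto simp: tleaves_eq card_1_singleton_iff)
  then show ?thesis by (simp add: lf_def)
qed

lemma bij_lf: "bij_betw lf (tleaves N root par) V"
proof (rule bij_betwI')
  fix s t assume st: "s \<in> tleaves N root par" "t \<in> tleaves N root par"
  then have "s \<in> N" "t \<in> N" by (auto simp: tleaves_eq)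
  then have "s = t" if "L s = L t" using that inj_L by (auto dest: inj_onD)
  then show "lf s = lf t \<longleftrightarrow> s = t" using L_leaf[OF st(1)] L_leaf[OF st(2)] by metis
next
  fix t assume t: "t \<in> tleaves N root par"
  then have "t \<in> N" by (simp add: tleaves_eq)
  then show "lf t \<in> V" using L_leaf[OF t] sub_V by blast
next
  fix v assume "v \<in> V"
  then obtain t where "t \<in> N" "L t = {v}" using singleton_in[of v] by (metis imageE)
  then have "t \<in> tleaves N root par" "v = lf t" by (simp_all add: tleaves_eq lf_def)
  then show "\<exists>t\<in>tleaves N root par. v = lf t" by blast
qed

text \<open>Labels only grow on the way up, so leaves below \<open>t\<close> have their vertex in
  \<open>L t\<close>; conversely the leaf of a vertex in \<open>L t\<close> reaches \<open>t\<close>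
  by \<open>reachable\<close>.\<close>

lemma Vt_eq:
  assumes "t \<in> N"
  shows "Vt N root par lf t = L t"
proof
  show "Vt N root par lf t \<subseteq> L t"
  proof
    fix v assume "v \<in> Vt N root par lf t"
    then obtain s i where "s \<in> tleaves N root par" "s \<in> N" "(par ^^ i) s = t" "v = lf s"
      by (auto simp: Vt_def subtree_def)
    then show "v \<in> L t" using par_funpow[of s i] L_leaf[of s] by blast
  qed
  show "L t \<subseteq> Vt N root par lf t"
  proof
    fix v assume v: "v \<in> L t"
    then obtain s where s: "s \<in> N" "L s = {v}"
      using singleton_in[of v] sub_V[OF assms] by (metis imageE subsetD)
    then have "s \<in> subtree N par t" using reachable[of s t] v assms by (auto simp: subtree_def)
    moreover have "s \<in> tleaves N root par" "lf s = v" using s by (auto simp: tleaves_eq lf_def)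
    ultimately show "v \<in> Vt N root par lf t" unfolding Vt_def by blast
  qed
qed

lemma hierarchy: "hierarchy V N root par lf"
  unfolding hierarchy_def
proof (intro conjI ballI impI)
  show "finite N" "root \<in> N" "par root = root" using finite_N root by (auto simp: par_def)
  show "bij_betw lf (tleaves N root par) V" by (rule bij_lf)
  show "par t \<in> N" if "t \<in> N - {root}" for t using that par_prop(1) eq_root_iff by blast
  show "\<exists>i. (par ^^ i) t = root" if "t \<in> N" for t using that reachable root sub_V by blast
  show "2 \<le> card (children N root par t)" if "t \<in> N" "children N root par t \<noteq> {}" for t
    using that(2) card_children[OF that(1)] ch_card[OF that(1)] ch_singleton[OF that(1)]
      L_children[OF that(1)] by fastforce
qed

lemma child_of_eq:
  assumes "t \<in> N" "c \<in> children N root par t" "v \<in> L c"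
  shows "child_of N root par lf t v = c"
  unfolding child_of_def
proof (rule the_equality)
  have N: "d \<in> N" if "d \<in> children N root par t" for d using that by (simp add: children_def)
  show "c \<in> children N root par t \<and> v \<in> Vt N root par lf c" using assms N Vt_eq by auto
  fix d assume "d \<in> children N root par t \<and> v \<in> Vt N root par lf d"
  then have d: "d \<in> children N root par t" "v \<in> L d" using N Vt_eq by auto
  have "L c = L d"
    using ch_disjoint[OF assms(1), of "L c" "L d"] d assms by (auto simp: children_eq)
  then show "d = c" using inj_L N d assms by (auto dest: inj_onD)
qed

text \<open>Contraction keeps cuts that are unions of children: an edge within one child becomes a
  deleted loop and was not cut before, and all other edges keep the sides of their ends. All claims
  about \<open>G{t}\<close> thus become claims about \<open>Ein E (L t)\<close>.\<close>

lemma bnd_contracted_edges: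
  assumes two: "\<forall>e\<in>#E. card e = 2" and t: "t \<in> N" "t \<notin> tleaves N root par"
    and S: "S \<subseteq> children N root par t"
  shows "bnd (contracted_edges E N root par lf t) S = bnd (Ein E (L t)) (\<Union>(L ` S))"
proof -
  let ?f = "child_of N root par lf t"
  have UN: "L t = \<Union>(L ` children N root par t)"
    using t ch_partition by (auto simp: L_children tleaves_eq partition_on_def)
  have f: "?f v \<in> S \<longleftrightarrow> v \<in> \<Union>(L ` S)" if v: "v \<in> L t" for v
  proof -
    obtain c where c: "c \<in> children N root par t" "v \<in> L c" using v UN by auto
    have fv: "?f v = c" by (rule child_of_eq[OF t(1) c])
    have "d = c" if "d \<in> S" "v \<in> L d" for d
      using child_of_eq[OF t(1) _ that(2)] S that fv by blast
    then show ?thesis unfolding fv using c(2) by blast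
  qed
  have "(e \<subseteq> L t \<and> card (?f ` e) = 2 \<and> card (?f ` e \<inter> S) = 1) \<longleftrightarrow>
        (e \<subseteq> L t \<and> card (e \<inter> \<Union>(L ` S)) = 1)" if eE: "e \<in># E" for e
  proof (cases "e \<subseteq> L t")
    case True
    obtain a b where e: "e = {a, b}" "a \<noteq> b" using two eE by (metis card_2_iff)
    define U where "U = \<Union>(L ` S)"
    have ab: "?f a \<in> S \<longleftrightarrow> a \<in> U" "?f b \<in> S \<longleftrightarrow> b \<in> U"
      using f[of a] f[of b] True e by (simp_all add: U_def)
    have "card (?f ` e) = 2 \<and> card (?f ` e \<inter> S) = 1 \<longleftrightarrow> card (e \<inter> U) = 1"
      using ab e by (cases "?f a = ?f b") (auto simp: Int_insert_left)
    then show ?thesis using True by (simp add: U_def)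
  qed auto
  then show ?thesis
    unfolding bnd_def contracted_edges_def Ein_def Vt_eq[OF t(1)] filter_mset_image_mset
      size_image_mset filter_filter_mset
    by (intro arg_cong[of _ _ size] filter_mset_cong) auto
qed

lemma LCH_well_cut:
  fixes k :: real
  assumes two: "\<forall>e\<in>#E. card e = 2"
    and wc: "\<And>t. t \<in> N \<Longrightarrow> card (L t) \<noteq> 1 \<Longrightarrow> well_cut E k (ch (L t))"
  shows "LCH V E N root par lf (k / 20) (1/4) (N - {root})"
  unfolding LCH_def
proof (intro conjI ballI)
  show "hierarchy V N root par lf" by (rule hierarchy)
  fix t
  show "k_edge_connected (Vt N root par lf t) (Ein E (Vt N root par lf t)) (k / 20)" if "t \<in> N"
    unfolding Vt_eq[OF that]
  proof (rule k_edge_connected_laminar[OF finite_L[OF that], of "L ` N"])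
    show "\<exists>C\<subseteq>L ` N. 2 \<le> card C \<and> partition_on X C \<and> well_cut E k C"
      if X: "X \<in> L ` N" "card X \<noteq> 1" for X
    proof -
      obtain s where "s \<in> N" "X = L s" using X(1) by blast
      then show ?thesis
        using X(2) wc[of s] ch_in[of s] ch_card[of s] ch_partition[of s]
        by (intro exI[of _ "ch X"]) simp
    qed
  qed (use that in simp)
  assume "t \<in> N - {root}"
  then have t: "t \<in> N" "L t \<noteq> V" using eq_root_iff by auto
  note p = par_prop[OF t]
  have sub: "L t \<subseteq> L (par t)" using ch_psubset p by blast
  have c1: "card (L (par t)) \<noteq> 1" using ch_singleton p by auto
  have "\<Union>(ch (L (par t))) = L (par t)" using ch_partition[OF p(1) c1] by (simp add: partition_on_def)
  then have "1/4 * real (bnd E (L t)) \<le> real (bnd (Ein E (L (par t))) (L t))"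
    using well_cutD(1)[OF wc[OF p(1) c1] p(2)] by simp
  moreover have "Pcount E V (L t) \<le> bnd E (L t)" by (rule Pcount_le_bnd[OF two sub_V[OF t(1)]])
  ultimately show "1/4 * real (Pcount E V (Vt N root par lf t))
      \<le> real (Ocount E (Vt N root par lf t) (Vt N root par lf (par t)))"
    using t p by (simp add: Vt_eq Ocount_eq_bnd_Ein[OF two sub])
qed simp

text \<open>Degrees in \<open>G{t}\<close> are boundaries of single nodes, so
  \<open>bnd_contracted_edges\<close> turns both cuts and volumes into the quantities of
  \<open>well_cut\<close>.\<close>

lemma expander_well_cut:
  fixes k :: real
  assumes two: "\<forall>e\<in>#E. card e = 2" and t: "t \<in> N" "t \<notin> tleaves N root par"
    and wc: "well_cut E k (ch (L t))"
  shows "expander (children N root par t) (contracted_edges E N root par lf t) (1 / k)"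
  unfolding expander_def
proof (intro allI impI)
  let ?ch = "children N root par t" and ?E = "contracted_edges E N root par lf t"
  fix S assume S: "S \<noteq> {} \<and> S \<subset> ?ch"
  have inj: "inj_on L ?ch" using inj_L by (rule inj_on_subset) (auto simp: children_def)
  have UC: "\<Union>(ch (L t)) = L t" using ch_partition t by (auto simp: tleaves_eq partition_on_def)
  have dsum: "dsum ?E A = (\<Sum>B\<in>L ` A. bnd (Ein E (L t)) B)" if "A \<subseteq> ?ch" for A
  proof -
    have "deg ?E c = bnd (Ein E (L t)) (L c)" if "c \<in> A" for c
      using bnd_contracted_edges[OF two t, of "{c}"] that \<open>A \<subseteq> ?ch\<close>
      by (simp add: deg_eq_bnd subset_iff)
    then show ?thesis unfolding dsum_def
      by (subst sum.reindex) (auto intro: inj_on_subset[OF inj that])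
  qed
  have "L ` (?ch - S) = ch (L t) - L ` S"
    using S inj_on_image_set_diff[OF inj, of ?ch S] L_children[OF t(1)] by auto
  moreover have "L ` S \<noteq> {}" "L ` S \<subset> ch (L t)"
    using S inj_on_image_eq_iff[OF inj, of S ?ch] L_children[OF t(1)] by blast+
  ultimately show "1 / k * real (min (dsum ?E S) (dsum ?E (?ch - S))) \<le> real (bnd ?E S)"
    using well_cutD(3)[OF wc, of "L ` S"] psubset_imp_subset[of S ?ch] S UC bnd_contracted_edges[OF two t, of S]
      dsum[of S] dsum[of "?ch - S"] by simp
qed

end

section \<open>Assembling the hierarchy from singleton blocks\<close>

theorem mainTheorem8:
  fixes V :: "'a set" and E :: "'a set multiset" and n k :: nat
  assumes "multigraph V E"
    and "card V = n" and "n \<ge> 2"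
    and "k_edge_connected V E (real k)"
    and "real k \<ge> 7 * log 2 (real n)"
  shows "\<exists>(N :: nat set) r par (lf :: nat \<Rightarrow> 'a).
           LCH V E N r par lf (real k / 20) (1/4) (N - {r}) \<and>
           (\<forall>t\<in>N - tleaves N r par.
              expander (children N r par t) (contracted_edges E N r par lf t) (1 / real k))"
proof -
  have fin: "finite V" and two: "\<forall>e\<in>#E. card e = 2" and sub: "\<forall>e\<in>#E. e \<subseteq> V"
    using assms(1) by (auto simp: multigraph_def)
  have ne: "V \<noteq> {}" using assms by auto
  \<comment> \<open>Positivity of \<open>k\<close> comes from \<open>n \<ge> 2\<close>, which gives
    \<open>k \<ge> 7\<close>.\<close>
  have "1 \<le> log 2 (real n)" using assms(3) by simp
  then have k: "0 < real k" "7 * log 2 (real (card V)) \<le> real k"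
    using assms(2,5) by simp_all
  define P where "P = (\<lambda>v. {v}) ` V"
  have "partition_on V P" unfolding P_def by (rule partition_on_singletons)
  from exists_laminar_family[OF fin two sub assms(4) k this ne]
  obtain F where LF: "laminar_over E (real k) V P F" by blast
  have F: "P \<subseteq> F" "V \<in> F" "F \<subseteq> Pow V" "{} \<notin> F"
    using LF by (simp_all add: laminar_over_def)
  have lam: "X \<subseteq> Y \<or> Y \<subseteq> X \<or> X \<inter> Y = {}" if "X \<in> F" "Y \<in> F" for X Y
    using LF that by (simp add: laminar_over_def)
  have dec: "\<forall>X\<in>F - P. \<exists>C. C \<subseteq> F \<and> 2 \<le> card C \<and> partition_on X C \<and> well_cut E (real k) C \<and>
              (\<forall>Y\<in>F. Y \<subset> X \<longrightarrow> (\<exists>c\<in>C. Y \<subseteq> c))"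
    using LF by (simp add: laminar_over_def)
  obtain D where D: "\<forall>X\<in>F - P. D X \<subseteq> F \<and> 2 \<le> card (D X) \<and> partition_on X (D X) \<and>
      well_cut E (real k) (D X) \<and> (\<forall>Y\<in>F. Y \<subset> X \<longrightarrow> (\<exists>c\<in>D X. Y \<subseteq> c))"
    using bchoice[OF dec] by blast
  \<comment> \<open>Singletons are the blocks of \<open>P\<close>, where \<open>D\<close> is
    unconstrained; they have to be leaves.\<close>
  define ch where "ch X = (if card X = 1 then {} else D X)" for X
  have PF: "X \<in> P \<longleftrightarrow> card X = 1" if "X \<in> F" for X
    using that F by (auto simp: P_def card_1_singleton_iff)
  have chD: "ch X \<subseteq> F" "2 \<le> card (ch X)" "partition_on X (ch X)" "well_cut E (real k) (ch X)"
    "\<And>Y. Y \<in> F \<Longrightarrow> Y \<subset> X \<Longrightarrow> \<exists>c\<in>ch X. Y \<subseteq> c" if "X \<in> F" "card X \<noteq> 1" for X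
    using D PF that by (auto simp: ch_def)
  have finF: "finite F" using F fin finite_subset by blast
  \<comment> \<open>Numbering the finite family turns its members into nodes of type
    \<open>nat\<close>.\<close>
  then obtain L where L: "bij_betw L {0..<card F} F" using ex_bij_betw_nat_finite by blast
  define N where "N = {0..<card F}"
  have LN: "L ` N = F" "inj_on L N" using L by (auto simp: bij_betw_def N_def)
  then have LF: "L t \<in> F" if "t \<in> N" for t using that by blast
  interpret T: labelled_laminar_family V N L ch
  proof
    show "finite V" "finite N" "inj_on L N" "V \<in> L ` N" using fin LN F by (auto simp: N_def)
    show "{v} \<in> L ` N" if "v \<in> V" for v using that LN F by (auto simp: P_def)
    fix t assume t: "t \<in> N"
    show "L t \<subseteq> V" "L t \<noteq> {}" using LF[OF t] F by auto
    show "ch (L t) = {}" if "card (L t) = 1" using that by (simp add: ch_def)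
    show "ch (L t) \<subseteq> L ` N" using chD(1)[OF LF[OF t]] LN by (cases "card (L t) = 1") (auto simp: ch_def)
    show "2 \<le> card (ch (L t))" "partition_on (L t) (ch (L t))" if "card (L t) \<noteq> 1"
      using chD LF[OF t] that by auto
    fix s assume s: "s \<in> N"
    show "L s \<subseteq> L t \<or> L t \<subseteq> L s \<or> L s \<inter> L t = {}" using lam LF s t by blast
    show "\<exists>c\<in>ch (L t). L s \<subseteq> c" if "L s \<subset> L t"
    proof (rule chD(5)[OF LF[OF t] _ LF[OF s] that])
      show "card (L t) \<noteq> 1"
      proof
        assume "card (L t) = 1"
        then obtain v where "L t = {v}" by (auto simp: card_1_singleton_iff)
        then have "L s = {}" using that by auto
        then show False using LF[OF s] F(4) by simp
      qed
    qed
  qed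
  have "LCH V E N T.root T.par T.lf (real k / 20) (1/4) (N - {T.root})"
    using chD(4) LF by (intro T.LCH_well_cut[OF two]) blast
  moreover have "expander (children N T.root T.par t) (contracted_edges E N T.root T.par T.lf t) (1 / real k)"
    if "t \<in> N - tleaves N T.root T.par" for t
    using that chD(4) LF by (intro T.expander_well_cut[OF two]) (auto simp: T.tleaves_eq)
  ultimately show ?thesis by blast
qed

end
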